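(* Recognizing relating edges and recognizing generating subgraphs in chordal graphs can be done in polynomial time. That is: (1) there is a polynomial-time algorithm which, given a chordal graph $G$ and an edge $xy \in E(G)$, decides whether $xy$ is a relating edge of $G$; and (2) there is a polynomial-time algorithm which, given a chordal graph $G$ and an induced complete bipartite subgraph $B$ of $G$, decides whether $B$ is a generating subgraph of $G$.
   Context: All graphs are finite, simple and undirected. A graph is chordal if every induced cycle is a triangle. A set of vertices is independent if its elements are pairwise nonadjacent; an independent set is maximal if it is not a proper subset of another independent set. Let $B$ be an induced complete bipartite subgraph of $G$ with (non-empty) bipartition sets $B_X$ and $B_Y$. $B$ is a generating subgraph of $G$ if there exists an independent set $S$ of $G$ such that each of $S \cup B_X$ and $S \cup B_Y$ is a maximal independent set of $G$. An edge $xy$ is relating if the subgraph $B$ with $B_X=\{x\}$, $B_Y=\{y\}$ (isomorphic to $K_{1,1}$) is generating. *)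

theory Defs
  imports "HOL-Library.Ramsey" "HOL-Computational_Algebra.Polynomial"
begin

section \<open>Chordal graphs and generating subgraphs\<close>

definition simple_graph :: "'a set \<Rightarrow> 'a set set \<Rightarrow> bool" where
  "simple_graph V E \<longleftrightarrow> finite V \<and> E \<subseteq> [V]\<^bsup>2\<^esup>"

text \<open>The cycle is given by its vertices in cyclic order; all other pairs of them are required
  to be nonadjacent.\<close>

definition induced_cycle :: "'a set \<Rightarrow> 'a set set \<Rightarrow> 'a list \<Rightarrow> bool" where
  "induced_cycle V E cs \<longleftrightarrow> 3 \<le> length cs \<and> distinct cs \<and> set cs \<subseteq> V \<and>
     (\<forall>i j. i < j \<and> j < length cs \<longrightarrow>
        ({cs ! i, cs ! j} \<in> E \<longleftrightarrow> j = Suc i \<or> (i = 0 \<and> Suc j = length cs)))"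

definition chordal :: "'a set \<Rightarrow> 'a set set \<Rightarrow> bool" where
  "chordal V E \<longleftrightarrow> (\<forall>cs. induced_cycle V E cs \<longrightarrow> length cs = 3)"

definition independent_set :: "'a set \<Rightarrow> 'a set set \<Rightarrow> 'a set \<Rightarrow> bool" where
  "independent_set V E S \<longleftrightarrow> S \<subseteq> V \<and> indep S E"

definition maximal_independent_set :: "'a set \<Rightarrow> 'a set set \<Rightarrow> 'a set \<Rightarrow> bool" where
  "maximal_independent_set V E S \<longleftrightarrow>
     independent_set V E S \<and> (\<nexists>T. independent_set V E T \<and> S \<subset> T)"

text \<open>An induced complete bipartite subgraph is represented by its two bipartition sets.\<close>

definition induced_complete_bipartite ::
    "'a set \<Rightarrow> 'a set set \<Rightarrow> 'a set \<Rightarrow> 'a set \<Rightarrow> bool" where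
  "induced_complete_bipartite V E X Y \<longleftrightarrow>
     X \<noteq> {} \<and> Y \<noteq> {} \<and> X \<inter> Y = {} \<and>
     independent_set V E X \<and> independent_set V E Y \<and> (\<forall>x\<in>X. \<forall>y\<in>Y. {x, y} \<in> E)"

definition generating :: "'a set \<Rightarrow> 'a set set \<Rightarrow> 'a set \<Rightarrow> 'a set \<Rightarrow> bool" where
  "generating V E X Y \<longleftrightarrow>
     (\<exists>S. independent_set V E S \<and>
          maximal_independent_set V E (S \<union> X) \<and> maximal_independent_set V E (S \<union> Y))"

definition relating :: "'a set \<Rightarrow> 'a set set \<Rightarrow> 'a \<Rightarrow> 'a \<Rightarrow> bool" where
  "relating V E x y \<longleftrightarrow> generating V E {x} {y}"


section \<open>Polynomial-time decidability\<close>

text \<open>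
  The machine model is the unit-cost random access machine with addition and truncated
  subtraction, in structured form. A state consists of registers, named by the program text,
  and of a memory, which is addressed indirectly through registers. There is deliberately no
  multiplication and no shift: in \<open>t\<close> steps the bit length of the numbers involved then grows
  by at most \<open>t\<close>, so that the model is polynomially equivalent to Turing machines.
\<close>

type_synonym ram_state = "(nat \<Rightarrow> nat) \<times> (nat \<Rightarrow> nat)"

datatype ram =
    Ram_Skip
  | Ram_Const nat nat
  | Ram_Add nat nat nat
  | Ram_Sub nat nat nat
  | Ram_Load nat nat
  | Ram_Store nat nat
  | Ram_Seq ram ram
  | Ram_If nat ram ram
  | Ram_While nat ram

text \<open>\<open>ram_exec c s t s'\<close>: started in state \<open>s\<close>, the program \<open>c\<close> halts in state \<open>s'\<close> after
  \<open>t\<close> steps.\<close>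

inductive ram_exec :: "ram \<Rightarrow> ram_state \<Rightarrow> nat \<Rightarrow> ram_state \<Rightarrow> bool" where
  Skip: "ram_exec Ram_Skip (r, m) 1 (r, m)"
| Const: "ram_exec (Ram_Const i k) (r, m) 1 (r(i := k), m)"
| Add: "ram_exec (Ram_Add i j k) (r, m) 1 (r(i := r j + r k), m)"
| Sub: "ram_exec (Ram_Sub i j k) (r, m) 1 (r(i := r j - r k), m)"
| Load: "ram_exec (Ram_Load i j) (r, m) 1 (r(i := m (r j)), m)"
| Store: "ram_exec (Ram_Store i j) (r, m) 1 (r, m(r i := r j))"
| Seq: "ram_exec c s t s' \<Longrightarrow> ram_exec d s' u s'' \<Longrightarrow> ram_exec (Ram_Seq c d) s (t + u) s''"
| IfTrue: "r i \<noteq> 0 \<Longrightarrow> ram_exec c (r, m) t s \<Longrightarrow> ram_exec (Ram_If i c d) (r, m) (Suc t) s"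
| IfFalse: "r i = 0 \<Longrightarrow> ram_exec d (r, m) t s \<Longrightarrow> ram_exec (Ram_If i c d) (r, m) (Suc t) s"
| WhileTrue: "r i \<noteq> 0 \<Longrightarrow> ram_exec c (r, m) t s \<Longrightarrow> ram_exec (Ram_While i c) s u s' \<Longrightarrow>
    ram_exec (Ram_While i c) (r, m) (Suc (t + u)) s'"
| WhileFalse: "r i = 0 \<Longrightarrow> ram_exec (Ram_While i c) (r, m) 1 (r, m)"

inductive_cases ram_execE:
  "ram_exec Ram_Skip s t s'"
  "ram_exec (Ram_Const i k) s t s'"
  "ram_exec (Ram_Add i j k) s t s'"
  "ram_exec (Ram_Sub i j k) s t s'"
  "ram_exec (Ram_Load i j) s t s'"
  "ram_exec (Ram_Store i j) s t s'"
  "ram_exec (Ram_Seq c d) s t s'"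
  "ram_exec (Ram_If i c d) s t s'"
  "ram_exec (Ram_While i c) s t s'"

lemma ram_exec_deterministic:
  "ram_exec c s t s' \<Longrightarrow> ram_exec c s u s'' \<Longrightarrow> u = t \<and> s'' = s'"
proof (induction arbitrary: u s'' rule: ram_exec.induct)
  case Seq
  from Seq.prems show ?case by (rule ram_execE) (blast dest: Seq.IH)
next
  case IfTrue
  from IfTrue.prems show ?case
    by (rule ram_execE) (use IfTrue.hyps(1) in \<open>simp; blast dest: IfTrue.IH\<close>)+
next
  case IfFalse
  from IfFalse.prems show ?case
    by (rule ram_execE) (use IfFalse.hyps(1) in \<open>simp; blast dest: IfFalse.IH\<close>)+
next
  case WhileTrue
  from WhileTrue.prems show ?case
    by (rule ram_execE) (use WhileTrue.hyps(1) in \<open>simp; blast dest: WhileTrue.IH\<close>)+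
next
  case WhileFalse
  from WhileFalse.prems show ?case
    by (rule ram_execE) (use WhileFalse.hyps in simp_all)
qed (erule ram_execE, simp)+

text \<open>The input is a bit string, held in the first cells of the memory; its length is in
  register 0.\<close>

definition ram_init :: "bool list \<Rightarrow> ram_state" where
  "ram_init w = ((\<lambda>_. 0)(0 := length w), \<lambda>i. of_bool (i < length w \<and> w ! i))"

text \<open>The question \<open>Q\<close> on the set \<open>I\<close> of admissible instances, which are presented to the machine
  as the bit strings \<open>code i\<close>. The answer is left in register 0. No behaviour is prescribed on
  other inputs.\<close>

definition polytime_decidable :: "('i \<Rightarrow> bool list) \<Rightarrow> 'i set \<Rightarrow> ('i \<Rightarrow> bool) \<Rightarrow> bool" where
  "polytime_decidable code I Q \<longleftrightarrow>
     (\<exists>(c :: ram) (p :: nat poly). \<forall>i\<in>I. \<exists>t r m.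
        ram_exec c (ram_init (code i)) t (r, m) \<and>
        t \<le> poly p (length (code i)) \<and>
        r 0 = of_bool (Q i))"

text \<open>
  A graph is encoded with respect to a list \<open>vs\<close> enumerating its vertices: the number of vertices
  in unary, followed by the adjacency matrix row by row. Sets of vertices are encoded by their
  characteristic vectors.
\<close>

definition vertex_set_code :: "'a list \<Rightarrow> 'a set \<Rightarrow> bool list" where
  "vertex_set_code vs X = map (\<lambda>v. v \<in> X) vs"

definition graph_code :: "'a list \<Rightarrow> 'a set set \<Rightarrow> bool list" where
  "graph_code vs E =
     replicate (length vs) True @ [False] @ concat (map (\<lambda>u. map (\<lambda>v. {u, v} \<in> E) vs) vs)"

fun edge_instance_code :: "'a list \<times> 'a set set \<times> 'a \<times> 'a \<Rightarrow> bool list" where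
  "edge_instance_code (vs, E, x, y) =
     graph_code vs E @ vertex_set_code vs {x} @ vertex_set_code vs {y}"

fun bipartite_instance_code :: "'a list \<times> 'a set set \<times> 'a set \<times> 'a set \<Rightarrow> bool list" where
  "bipartite_instance_code (vs, E, X, Y) =
     graph_code vs E @ vertex_set_code vs X @ vertex_set_code vs Y"

end

(*
The vertices of Y are adjacent to all of X and vice versa, so the vertices that S has to dominate
are those in exactly one of the closed neighbourhoods N[X] and N[Y], and S lives in the set R of
vertices in neither. In a chordal graph it is enough that each vertex to be dominated has some
neighbour in R: for a component C of R, the vertices with neighbours both in C and in X \<union> Y
have a common neighbour in C (two of them that are not adjacent would lie on a long induced cycle
through C and X \<union> Y, and the same argument along an induced path in C shows that a vertex of C
dominating the most of them dominates all), and choosing one such vertex in each component gives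
an independent set. This criterion is a first-order sentence about the graph, which a machine
evaluates by nested loops over the vertices.
*)
theory Submission
  imports Defs
begin

section \<open>Induced paths and cycles\<close>

text \<open>Recursion at the head lets walks be shortened from the front; each vertex is compared
  with all later ones, so no chord can appear.\<close>

fun induced_path :: "'a set set \<Rightarrow> 'a list \<Rightarrow> bool" where
  "induced_path E [] \<longleftrightarrow> True"
| "induced_path E [x] \<longleftrightarrow> True"
| "induced_path E (x # y # zs) \<longleftrightarrow>
     x \<notin> set (y # zs) \<and> {x, y} \<in> E \<and> (\<forall>z\<in>set zs. {x, z} \<notin> E) \<and> induced_path E (y # zs)"

lemma induced_path_distinct: "induced_path E p \<Longrightarrow> distinct p"
  by (induction E p rule: induced_path.induct) auto

lemma induced_path_suffix: "induced_path E (p @ q) \<Longrightarrow> induced_path E q"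
proof (induction p)
  case (Cons x p)
  then show ?case by (cases "p @ q") auto
qed simp

lemma induced_path_prefix: "induced_path E (p @ q) \<Longrightarrow> induced_path E p"
  by (induction E p rule: induced_path.induct) auto

lemma induced_path_nth:
  "induced_path E p \<Longrightarrow> i < j \<Longrightarrow> j < length p \<Longrightarrow> {p ! i, p ! j} \<in> E \<longleftrightarrow> j = Suc i"
proof (induction E p arbitrary: i j rule: induced_path.induct)
  case (3 E x y zs)
  then obtain j' where j: "j = Suc j'" by (cases j) auto
  show ?case
  proof (cases i)
    case 0
    then show ?thesis using 3 j by (cases j') auto
  next
    case (Suc i')
    then show ?thesis using "3.IH"[of i' j'] "3.prems" j by simp
  qed
qed auto

section \<open>Connectivity inside a vertex set and induced cycles\<close>

definition adj_in :: "'a set set \<Rightarrow> 'a set \<Rightarrow> ('a \<times> 'a) set" where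
  "adj_in E W = {(a, b). a \<in> W \<and> b \<in> W \<and> {a, b} \<in> E}"

lemma sym_adj_in: "sym (adj_in E W)"
  by (auto simp: adj_in_def sym_def insert_commute)

lemma adj_in_mono: "W \<subseteq> W' \<Longrightarrow> (adj_in E W)\<^sup>* \<subseteq> (adj_in E W')\<^sup>*"
  by (rule rtrancl_mono) (auto simp: adj_in_def)

lemma adj_in_rtrancl_mem: "(a, b) \<in> (adj_in E W)\<^sup>* \<Longrightarrow> a \<in> W \<Longrightarrow> b \<in> W"
  by (induction rule: rtrancl_induct) (auto simp: adj_in_def)

text \<open>The walk is shortened while it is built from its end. A new first vertex
  \<open>c\<close> either lies on the path already, which is then cut at \<open>c\<close>, or is
  joined to its last neighbour on the path, which skips every chord at \<open>c\<close>. The premise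
  \<open>b \<in> W\<close> matters because the closure is reflexive outside \<open>W\<close> as
  well.\<close>

lemma induced_path_exists:
  assumes "(a, b) \<in> (adj_in E W)\<^sup>*" "b \<in> W"
  shows "\<exists>p. induced_path E p \<and> set p \<subseteq> W \<and> p \<noteq> [] \<and> hd p = a \<and> last p = b"
  using assms(1)
proof (induction rule: converse_rtrancl_induct)
  case base
  show ?case by (rule exI[of _ "[b]"]) (use assms(2) in simp)
next
  case (step c a)
  then obtain p where p: "induced_path E p" "set p \<subseteq> W" "p \<noteq> []" "hd p = a" "last p = b"
    by blast
  have c: "c \<in> W" "{c, a} \<in> E" using step.hyps(1) by (auto simp: adj_in_def)
  show ?case
  proof (cases "c \<in> set p")
    case True
    then obtain us ws where "p = us @ c # ws" by (meson split_list)
    then show ?thesis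
      using p induced_path_suffix[of E us "c # ws"] by (intro exI[of _ "c # ws"]) auto
  next
    case False
    have "a \<in> set p" using p by auto
    then have "\<exists>y\<in>set p. {c, y} \<in> E" using c by blast
    from split_list_last_prop[OF this] obtain us y ws
      where s: "p = us @ y # ws" "{c, y} \<in> E" "\<forall>z\<in>set ws. {c, z} \<notin> E" by blast
    have "induced_path E (c # y # ws)"
      using p s False induced_path_suffix[of E us "y # ws"] by auto
    then show ?thesis using p s c by (intro exI[of _ "c # y # ws"]) auto
  qed
qed

text \<open>The only edges between \<open>p\<close> and \<open>q\<close> close them up at both ends,
  so \<open>p @ q\<close> is an induced cycle, and it has at least four vertices.\<close>

lemma chordal_no_two_paths:
  assumes "chordal V E" and p: "induced_path E p" "2 \<le> length p" "set p \<subseteq> V"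
    and q: "induced_path E q" "2 \<le> length q" "set q \<subseteq> V"
    and disj: "set p \<inter> set q = {}"
    and cross: "\<And>u v. u \<in> set p \<Longrightarrow> v \<in> set q \<Longrightarrow>
      {u, v} \<in> E \<longleftrightarrow> (u = last p \<and> v = hd q) \<or> (u = hd p \<and> v = last q)"
  shows False
proof -
  have ne: "p \<noteq> []" "q \<noteq> []" using p q by auto
  have dist: "distinct p" "distinct q" using p q by (auto intro: induced_path_distinct)
  have "induced_cycle V E (p @ q)"
    unfolding induced_cycle_def
  proof (intro conjI allI impI)
    fix i j assume ij: "i < j \<and> j < length (p @ q)"
    show "{(p @ q) ! i, (p @ q) ! j} \<in> E \<longleftrightarrow> j = Suc i \<or> i = 0 \<and> Suc j = length (p @ q)"
    proof (cases "j < length p")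
      case True
      then show ?thesis using ij induced_path_nth[OF p(1), of i j] q by (auto simp: nth_append)
    next
      case j: False
      show ?thesis
      proof (cases "i < length p")
        case False
        then show ?thesis
          using ij j induced_path_nth[OF q(1), of "i - length p" "j - length p"] p
          by (simp add: nth_append; arith)
      next
        case True
        \<comment> \<open>The index \<open>j\<close> lies in \<open>q\<close>, at position
          \<open>k\<close>; distinctness turns the end vertices named in \<open>cross\<close> into
          end positions.\<close>
        define k where "k = j - length p"
        have k: "j = k + length p" "k < length q" using j ij by (auto simp: k_def)
        have "{p ! i, q ! k} \<in> E \<longleftrightarrow> (p ! i = last p \<and> q ! k = hd q) \<or> (p ! i = hd p \<and> q ! k = last q)"
          using cross[of "p ! i" "q ! k"] True k by auto
        moreover have "p ! i = last p \<longleftrightarrow> i = length p - 1"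
          using dist(1) True ne by (simp add: last_conv_nth nth_eq_iff_index_eq)
        moreover have "p ! i = hd p \<longleftrightarrow> i = 0"
          using dist(1) True ne by (simp add: hd_conv_nth nth_eq_iff_index_eq)
        moreover have "q ! k = last q \<longleftrightarrow> k = length q - 1"
          using dist(2) k ne by (simp add: last_conv_nth nth_eq_iff_index_eq)
        moreover have "q ! k = hd q \<longleftrightarrow> k = 0"
          using dist(2) k ne by (simp add: hd_conv_nth nth_eq_iff_index_eq)
        ultimately have "{p ! i, q ! k} \<in> E \<longleftrightarrow>
            (i = length p - 1 \<and> k = 0) \<or> (i = 0 \<and> k = length q - 1)" by simp
        also have "\<dots> \<longleftrightarrow> j = Suc i \<or> i = 0 \<and> Suc j = length (p @ q)"
          using True k p(2) q(2) unfolding length_append by arith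
        finally show ?thesis using True k by (simp add: nth_append)
      qed
    qed
  qed (use assms dist in auto)
  then have "length (p @ q) = 3" using assms(1) unfolding chordal_def by blast
  then show False using p q by auto
qed

text \<open>Take \<open>c\<close> in \<open>C\<close> with the most neighbours among the outside
  vertices attached to both \<open>C\<close> and \<open>U\<close>. If \<open>c\<close> misses such a
  \<open>k\<close>, the first vertex \<open>z\<close> of \<open>C\<close> on an induced path from
  \<open>k\<close> to \<open>c\<close> sees \<open>k\<close> and, by chordality, all that
  \<open>c\<close> sees: a contradiction.\<close>

lemma chordal_dominating_vertex:
  assumes "chordal V E" "finite V" "C \<subseteq> V" "C \<noteq> {}" "U \<subseteq> V"
    and conC: "\<And>a b. a \<in> C \<Longrightarrow> b \<in> C \<Longrightarrow> (a, b) \<in> (adj_in E C)\<^sup>*"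
    and conU: "\<And>a b. a \<in> U \<Longrightarrow> b \<in> U \<Longrightarrow> (a, b) \<in> (adj_in E U)\<^sup>*"
    and disj: "C \<inter> U = {}" and anti: "\<And>a b. a \<in> C \<Longrightarrow> b \<in> U \<Longrightarrow> {a, b} \<notin> E"
  shows "\<exists>c\<in>C. \<forall>k\<in>V - C - U. (\<exists>a\<in>C. {a, k} \<in> E) \<longrightarrow> (\<exists>b\<in>U. {b, k} \<in> E) \<longrightarrow> {c, k} \<in> E"
proof -
  define M where "M = {k \<in> V - C - U. (\<exists>a\<in>C. {a, k} \<in> E) \<and> (\<exists>b\<in>U. {b, k} \<in> E)}"
  define N where "N c = {k \<in> M. {c, k} \<in> E}" for c
  have finM: "finite M" using \<open>finite V\<close> by (simp add: M_def)
  have "\<forall>c. c \<in> C \<longrightarrow> card (N c) < Suc (card M)"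
    using card_mono[OF finM] by (auto simp: N_def less_Suc_eq_le)
  then obtain c where c: "c \<in> C" and cmax: "\<And>z. z \<in> C \<Longrightarrow> card (N z) \<le> card (N c)"
    using ex_has_greatest_nat[of "\<lambda>c. c \<in> C" _ "\<lambda>c. card (N c)" "Suc (card M)"] \<open>C \<noteq> {}\<close>
    by blast
  have "{c, k} \<in> E" if k: "k \<in> M" for k
  proof (rule ccontr)
    assume nk: "{c, k} \<notin> E"
    obtain a where a: "a \<in> C" "{a, k} \<in> E" using k by (auto simp: M_def)
    have kC: "k \<notin> C" "k \<notin> U" "k \<in> V" using k by (auto simp: M_def)
    \<comment> \<open>An induced path from \<open>k\<close> to \<open>c\<close> that stays in
      \<open>C\<close> after \<open>k\<close>: only its second vertex \<open>z\<close> is adjacent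
      to \<open>k\<close>.\<close>
    have "(a, c) \<in> (adj_in E (insert k C))\<^sup>*"
      using conC[OF a(1) c] adj_in_mono[of C "insert k C" E] by blast
    moreover have "(k, a) \<in> adj_in E (insert k C)"
      using a by (auto simp: adj_in_def insert_commute)
    ultimately have "(k, c) \<in> (adj_in E (insert k C))\<^sup>*" by (rule converse_rtrancl_into_rtrancl[rotated])
    then obtain p0 where p0: "induced_path E p0" "set p0 \<subseteq> insert k C" "p0 \<noteq> []" "hd p0 = k" "last p0 = c"
      using induced_path_exists[of k c E "insert k C"] c by auto
    then obtain z p where p: "p0 = k # z # p"
      using c kC by (metis last.simps list.collapse list.exhaust_sel list.sel(1))
    have zp: "set (z # p) \<subseteq> C" "induced_path E (z # p)" "{k, z} \<in> E"
      "\<forall>y\<in>set p. {k, y} \<notin> E" "last (z # p) = c"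
      using p0 p by auto
    have "{z, k'} \<in> E" if k': "k' \<in> M" "{c, k'} \<in> E" for k'
    proof (rule ccontr)
      assume nz: "{z, k'} \<notin> E"
      have k'C: "k' \<notin> C" "k' \<notin> U" "k' \<in> V" "k' \<noteq> k" using k' nk by (auto simp: M_def)
      \<comment> \<open>The path from \<open>z\<close> is cut at the first neighbour
        \<open>y\<close> of \<open>k'\<close>, which exists because \<open>c\<close> is one. Since
        \<open>z\<close> is not, the segment \<open>?P\<close> has at least two vertices.\<close>
      have "\<exists>y\<in>set (z # p). {y, k'} \<in> E" using zp(5) k'(2) last_in_set[of "z # p"] by blast
      from split_list_first_prop[OF this] obtain us y ws
        where s: "z # p = us @ y # ws" "{y, k'} \<in> E" "\<forall>u\<in>set us. {u, k'} \<notin> E" by blast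
      then obtain us' where us: "us = z # us'" using nz by (cases us) auto
      let ?P = "us @ [y]"
      have P: "induced_path E ?P" using zp(2) s(1) induced_path_prefix[of E ?P ws] by simp
      have PC: "set ?P \<subseteq> C" using zp(1) s(1) by auto
      have disP: "distinct ?P" using P by (rule induced_path_distinct)
      obtain b b' where b: "b \<in> U" "{b, k} \<in> E" "b' \<in> U" "{b', k'} \<in> E"
        using k k'(1) by (auto simp: M_def)
      \<comment> \<open>The cycle returns from \<open>k'\<close> to \<open>k\<close> through
        \<open>U\<close>; if \<open>k\<close> and \<open>k'\<close> are adjacent, the induced path
        \<open>Q\<close> is just that edge.\<close>
      let ?W = "insert k (insert k' U)"
      have "(b', b) \<in> (adj_in E ?W)\<^sup>*" using conU[OF b(3,1)] adj_in_mono[of U ?W E] by blast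
      moreover have "(k', b') \<in> adj_in E ?W" "(b, k) \<in> adj_in E ?W"
        using b by (auto simp: adj_in_def insert_commute)
      ultimately have "(k', k) \<in> (adj_in E ?W)\<^sup>*"
        by (meson converse_rtrancl_into_rtrancl rtrancl.rtrancl_into_rtrancl)
      then obtain Q where Q: "induced_path E Q" "set Q \<subseteq> ?W" "Q \<noteq> []" "hd Q = k'" "last Q = k"
        using induced_path_exists[of k' k E ?W] by auto
      have lenQ: "2 \<le> length Q" using Q k'C(4) by (cases Q; cases "tl Q"; auto)
      have kP: "{u, k} \<in> E \<longleftrightarrow> u = z" if "u \<in> set ?P" for u
        using that zp(3,4) s(1) us by (auto simp: insert_commute)
      have k'P: "{u, k'} \<in> E \<longleftrightarrow> u = y" if "u \<in> set ?P" for u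
        using that s(2,3) disP by auto
      show False
      proof (rule chordal_no_two_paths[OF \<open>chordal V E\<close> P _ _ Q(1) lenQ])
        show "set ?P \<inter> set Q = {}" using PC Q(2) disj kC k'C by blast
        show "{u, v} \<in> E \<longleftrightarrow> (u = last ?P \<and> v = hd Q) \<or> (u = hd ?P \<and> v = last Q)"
          if u: "u \<in> set ?P" and v: "v \<in> set Q" for u v
        proof -
          have "u \<in> C" using u PC by blast
          consider "v = k" | "v = k'" | "v \<in> U" using v Q(2) by blast
          then show ?thesis
          proof cases
            case 1 then show ?thesis using kP[OF u] Q k'C us by auto
          next
            case 2 then show ?thesis using k'P[OF u] Q k'C us by auto
          next
            case 3 then show ?thesis using anti[OF \<open>u \<in> C\<close>] Q kC k'C by auto
          qed
        qed
      qed (use us PC Q(2) assms(3,5) kC k'C in auto)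
    qed
    then have "insert k (N c) \<subseteq> N z" using k zp(3) by (auto simp: N_def insert_commute)
    moreover have "k \<notin> N c" using nk by (simp add: N_def)
    moreover have "finite (N z)" "finite (N c)" using finM by (auto simp: N_def)
    ultimately have "Suc (card (N c)) \<le> card (N z)" by (metis card_insert_disjoint card_mono)
    then show False using cmax[of z] zp(1) by simp
  qed
  then show ?thesis using c by (auto simp: M_def)
qed

section \<open>Generating subgraphs of chordal graphs\<close>

lemma simple_graph_edgeD:
  assumes "simple_graph V E" "{a, b} \<in> E"
  shows "a \<in> V" "b \<in> V" "a \<noteq> b"
proof -
  have "{a, b} \<subseteq> V" "card {a, b} = 2" using assms by (auto simp: simple_graph_def nsets_def)
  then show "a \<in> V" "b \<in> V" "a \<noteq> b" by auto
qed

section \<open>Maximality as domination\<close>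

lemma maximal_independent_set_iff:
  assumes "simple_graph V E"
  shows "maximal_independent_set V E S \<longleftrightarrow>
    independent_set V E S \<and> (\<forall>v\<in>V - S. \<exists>w\<in>S. {v, w} \<in> E)"
proof (intro iffI conjI ballI)
  fix v assume S: "maximal_independent_set V E S" and v: "v \<in> V - S"
  have "\<not> independent_set V E (insert v S)"
    using S v unfolding maximal_independent_set_def by blast
  then show "\<exists>w\<in>S. {v, w} \<in> E"
    using S v unfolding maximal_independent_set_def independent_set_def indep_def
    by (auto simp: insert_commute)
next
  assume S: "independent_set V E S \<and> (\<forall>v\<in>V - S. \<exists>w\<in>S. {v, w} \<in> E)"
  have False if T: "independent_set V E T" "S \<subset> T" for T
  proof -
    obtain v where v: "v \<in> T" "v \<notin> S" using T by blast
    moreover have "v \<in> V" using T v by (auto simp: independent_set_def)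
    ultimately obtain w where w: "w \<in> S" "{v, w} \<in> E" using S by blast
    then have "w \<in> T" "v \<noteq> w" using v T by auto
    then show False using v T w by (auto simp: independent_set_def indep_def)
  qed
  then show "maximal_independent_set V E S" using S unfolding maximal_independent_set_def by blast
qed (simp add: maximal_independent_set_def)

text \<open>The extension is maximal only relative to \<open>R\<close>. With \<open>R\<close> the
  vertices outside both closed neighbourhoods, the added vertices cannot conflict with
  \<open>X\<close> or \<open>Y\<close>.\<close>

lemma independent_set_extend:
  assumes "finite R" "R \<subseteq> V" "S \<subseteq> R" "independent_set V E S"
  shows "\<exists>T. S \<subseteq> T \<and> T \<subseteq> R \<and> independent_set V E T \<and> (\<forall>v\<in>R - T. \<exists>w\<in>T. {v, w} \<in> E)"
proof -
  let ?F = "{T. S \<subseteq> T \<and> T \<subseteq> R \<and> independent_set V E T}"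
  have "finite ?F" by (rule finite_subset[of _ "Pow R"]) (use assms(1) in auto)
  moreover have "?F \<noteq> {}" using assms by auto
  ultimately obtain T where T: "T \<in> ?F" and Tmax: "\<forall>T'\<in>?F. T \<subseteq> T' \<longrightarrow> T = T'"
    using finite_has_maximal[of ?F] by meson
  have "\<exists>w\<in>T. {v, w} \<in> E" if v: "v \<in> R - T" for v
  proof -
    have "insert v T \<notin> ?F" using Tmax v by blast
    then show ?thesis using v T assms(2) by (auto simp: independent_set_def indep_def insert_commute)
  qed
  then show ?thesis using T by blast
qed

section \<open>The domination criterion for generating subgraphs\<close>

definition closed_nbhd :: "'a set set \<Rightarrow> 'a set \<Rightarrow> 'a set" where
  "closed_nbhd E X = X \<union> {v. \<exists>x\<in>X. {x, v} \<in> E}"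

text \<open>Maximality of \<open>S \<union> Y\<close> gives \<open>v\<close> a neighbour there,
  which is not in \<open>Y\<close> and hence is in \<open>S\<close>. This is one half of the
  necessity; the other follows by exchanging \<open>X\<close> and \<open>Y\<close>.\<close>

lemma generating_imp_dominated:
  assumes G: "simple_graph V E" and B: "induced_complete_bipartite V E X Y"
    and "generating V E X Y" and v: "v \<in> closed_nbhd E X" "v \<notin> closed_nbhd E Y"
  shows "\<exists>w\<in>V. {v, w} \<in> E \<and> w \<notin> closed_nbhd E X \<and> w \<notin> closed_nbhd E Y"
proof -
  obtain S where SX: "independent_set V E (S \<union> X)" and SY: "maximal_independent_set V E (S \<union> Y)"
    using assms(3) unfolding generating_def maximal_independent_set_def by blast
  have SY': "independent_set V E (S \<union> Y)" "\<forall>u\<in>V - (S \<union> Y). \<exists>w\<in>S \<union> Y. {u, w} \<in> E"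
    using SY by (auto simp: maximal_independent_set_iff[OF G])
  have XY: "\<exists>x. x \<in> X" "\<exists>y. y \<in> Y" "\<And>x y. x \<in> X \<Longrightarrow> y \<in> Y \<Longrightarrow> {x, y} \<in> E"
    using B by (auto simp: induced_complete_bipartite_def)
  have nadj: "{s, u} \<notin> E" if "s \<in> S" "u \<in> X \<union> Y \<union> S" for s u
  proof
    assume e: "{s, u} \<in> E"
    then have "s \<noteq> u" using simple_graph_edgeD[OF G e] by blast
    then show False using that e SX SY'(1) by (auto simp: independent_set_def indep_def)
  qed
  \<comment> \<open>A vertex of \<open>S\<close> cannot belong to \<open>X\<close> or
    \<open>Y\<close> either, since it would be adjacent to the opposite side.\<close>
  have Sfar: "s \<notin> closed_nbhd E X \<and> s \<notin> closed_nbhd E Y" if "s \<in> S" for s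
    using nadj[OF that] XY by (auto simp: closed_nbhd_def) (metis insert_commute)+
  have "v \<in> V" using v B simple_graph_edgeD[OF G]
    by (auto simp: closed_nbhd_def induced_complete_bipartite_def independent_set_def)
  moreover have "v \<notin> S" using Sfar v by blast
  moreover have "v \<notin> Y" using v by (simp add: closed_nbhd_def)
  ultimately obtain w where w: "w \<in> S \<union> Y" "{v, w} \<in> E" using SY'(2) by blast
  then have "w \<in> S" using v by (auto simp: closed_nbhd_def insert_commute)
  then show ?thesis using w Sfar simple_graph_edgeD[OF G w(2)] by blast
qed

lemma generating_iff_dominated:
  assumes G: "simple_graph V E" and ch: "chordal V E" and B: "induced_complete_bipartite V E X Y"
  shows "generating V E X Y \<longleftrightarrow>
    (\<forall>v\<in>V. (v \<in> closed_nbhd E X) \<noteq> (v \<in> closed_nbhd E Y) \<longrightarrow>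
      (\<exists>w\<in>V. {v, w} \<in> E \<and> w \<notin> closed_nbhd E X \<and> w \<notin> closed_nbhd E Y))" (is "_ \<longleftrightarrow> ?R")
proof
  have "generating V E Y X" if "generating V E X Y" using that by (auto simp: generating_def)
  moreover have "induced_complete_bipartite V E Y X"
    using B unfolding induced_complete_bipartite_def by (metis insert_commute inf_commute)
  ultimately show ?R if "generating V E X Y"
    using that generating_imp_dominated[OF G B] generating_imp_dominated[OF G, of Y X] by metis
next
  assume dom: ?R
  have XY: "\<exists>x. x \<in> X" "\<exists>y. y \<in> Y" "\<And>x y. x \<in> X \<Longrightarrow> y \<in> Y \<Longrightarrow> {x, y} \<in> E"
    "independent_set V E X" "independent_set V E Y" "X \<subseteq> V" "Y \<subseteq> V"
    using B by (auto simp: induced_complete_bipartite_def independent_set_def)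
  have finV: "finite V" using G by (simp add: simple_graph_def)
  define R where "R = V - closed_nbhd E X - closed_nbhd E Y"
  have RXY: "{r, u} \<notin> E" if "r \<in> R" "u \<in> X \<union> Y" for r u
    using that by (auto simp: R_def closed_nbhd_def insert_commute)
  \<comment> \<open>The connected component of \<open>r\<close> in the subgraph induced by
    \<open>R\<close>.\<close>
  define comp where "comp r = {w. (r, w) \<in> (adj_in E R)\<^sup>*}" for r
  have sym: "sym ((adj_in E R)\<^sup>*)" using sym_adj_in by (rule sym_rtrancl)
  have comp_eq: "comp r = comp s" if "(r, s) \<in> (adj_in E R)\<^sup>*" for r s
    using that symD[OF sym that] by (auto simp: comp_def intro: rtrancl_trans)
  have comp_sub: "comp r \<subseteq> R" if "r \<in> R" for r
    using that adj_in_rtrancl_mem[of r _ E R] by (auto simp: comp_def)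
  have comp_con: "(a, b) \<in> (adj_in E (comp r))\<^sup>*" if "a \<in> comp r" "b \<in> comp r" for a b r
  proof -
    have "comp a = comp r" using that comp_eq by (auto simp: comp_def)
    then have "(a, b) \<in> (adj_in E R)\<^sup>*" using that by (auto simp: comp_def)
    then show ?thesis
    proof (induction rule: rtrancl_induct)
      case (step y z)
      then have "y \<in> comp a" "z \<in> comp a" by (auto simp: comp_def)
      then have "(y, z) \<in> adj_in E (comp r)"
        using step.hyps(2) \<open>comp a = comp r\<close> by (auto simp: adj_in_def)
      then show ?case using step.IH by simp
    qed simp
  qed
  \<comment> \<open>Every vertex of \<open>X \<union> Y\<close> reaches a fixed \<open>x\<close> in
    \<open>X\<close>, directly from \<open>Y\<close> or through a fixed \<open>y\<close> from
    \<open>X\<close>.\<close>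
  have conU: "(a, b) \<in> (adj_in E (X \<union> Y))\<^sup>*" if ab: "a \<in> X \<union> Y" "b \<in> X \<union> Y" for a b
  proof -
    have e: "(x, y) \<in> adj_in E (X \<union> Y)" "(y, x) \<in> adj_in E (X \<union> Y)" if "x \<in> X" "y \<in> Y" for x y
      using XY(3)[OF that] that by (auto simp: adj_in_def insert_commute)
    obtain x y where "x \<in> X" "y \<in> Y" using XY by blast
    have to_x: "(u, x) \<in> (adj_in E (X \<union> Y))\<^sup>*" if "u \<in> X \<union> Y" for u
    proof (cases "u \<in> X")
      case True
      then show ?thesis
        using e(1)[of u y] e(2)[of x y] \<open>x \<in> X\<close> \<open>y \<in> Y\<close> by (meson converse_rtrancl_into_rtrancl r_into_rtrancl)
    next
      case False
      then show ?thesis using e(2)[of x u] \<open>x \<in> X\<close> that by blast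
    qed
    show ?thesis
      using to_x[OF ab(1)] symD[OF sym_rtrancl[OF sym_adj_in] to_x[OF ab(2)]]
      by (rule rtrancl_trans)
  qed
  have "\<exists>c\<in>comp r. \<forall>k\<in>V - comp r - (X \<union> Y).
      (\<exists>a\<in>comp r. {a, k} \<in> E) \<longrightarrow> (\<exists>b\<in>X \<union> Y. {b, k} \<in> E) \<longrightarrow> {c, k} \<in> E" if r: "r \<in> R" for r
  proof (rule chordal_dominating_vertex[OF ch finV])
    show "comp r \<noteq> {}" by (auto simp: comp_def)
    show "comp r \<inter> (X \<union> Y) = {}" using comp_sub[OF r] by (auto simp: R_def closed_nbhd_def)
    show "{a, b} \<notin> E" if "a \<in> comp r" "b \<in> X \<union> Y" for a b
      using RXY comp_sub[OF r] that by blast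
  qed (use comp_sub[OF r] comp_con conU XY in \<open>auto simp: R_def\<close>)
  then obtain f0 where f0: "\<And>r. r \<in> R \<Longrightarrow> f0 r \<in> comp r \<and> (\<forall>k\<in>V - comp r - (X \<union> Y).
      (\<exists>a\<in>comp r. {a, k} \<in> E) \<longrightarrow> (\<exists>b\<in>X \<union> Y. {b, k} \<in> E) \<longrightarrow> {f0 r, k} \<in> E)"
    by metis
  \<comment> \<open>\<open>f0\<close> is evaluated at a representative that depends on the component
    only, so each component gets a single chosen vertex.\<close>
  define f where "f r = f0 (SOME s. s \<in> R \<and> comp s = comp r)" for r
  have f: "f r \<in> comp r" "\<And>k a b. k \<in> V - comp r - (X \<union> Y) \<Longrightarrow> a \<in> comp r \<Longrightarrow> {a, k} \<in> E \<Longrightarrow>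
      b \<in> X \<union> Y \<Longrightarrow> {b, k} \<in> E \<Longrightarrow> {f r, k} \<in> E" if "r \<in> R" for r
  proof -
    define s where "s = (SOME s. s \<in> R \<and> comp s = comp r)"
    have s: "s \<in> R \<and> comp s = comp r" unfolding s_def by (rule someI[of _ r]) (use that in simp)
    show "f r \<in> comp r" using f0[of s] s unfolding f_def s_def[symmetric] by simp
    show "{f r, k} \<in> E" if "k \<in> V - comp r - (X \<union> Y)" "a \<in> comp r" "{a, k} \<in> E"
      "b \<in> X \<union> Y" "{b, k} \<in> E" for k a b
      using f0[of s] s that unfolding f_def s_def[symmetric] by blast
  qed
  have f_cong: "f r = f s" if "comp r = comp s" for r s using that by (simp add: f_def)
  have fR: "f ` R \<subseteq> R" using f(1) comp_sub by blast
  \<comment> \<open>Adjacent chosen vertices would lie in one component and therefore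
    coincide.\<close>
  have "indep (f ` R) E"
    unfolding indep_def
  proof (intro ballI impI notI)
    fix s s' assume "s \<in> f ` R" "s' \<in> f ` R" and ne: "s \<noteq> s'" and e: "{s, s'} \<in> E"
    then obtain r r' where r: "r \<in> R" "r' \<in> R" "s = f r" "s' = f r'" by blast
    then have ss: "(s, s') \<in> adj_in E R" using e fR by (auto simp: adj_in_def)
    have "comp r = comp s" "comp r' = comp s'" using f(1) r comp_eq by (auto simp: comp_def)
    moreover have "comp s = comp s'" using ss comp_eq by blast
    ultimately show False using f_cong[of r r'] r ne by simp
  qed
  then have "independent_set V E (f ` R)" using fR by (auto simp: independent_set_def R_def)
  moreover have "finite R" "R \<subseteq> V" using finV by (auto simp: R_def)
  ultimately obtain S where S: "f ` R \<subseteq> S" "S \<subseteq> R" "independent_set V E S"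
      "\<And>v. v \<in> R - S \<Longrightarrow> \<exists>w\<in>S. {v, w} \<in> E"
    using independent_set_extend[of R V "f ` R" E] fR by blast
  \<comment> \<open>The criterion supplies a neighbour \<open>w\<close> of \<open>v\<close> in
    \<open>R\<close>; the vertex chosen for the component of \<open>w\<close> then dominates
    \<open>v\<close>.\<close>
  have D: "\<exists>w\<in>S. {v, w} \<in> E" if v: "v \<in> V" "v \<notin> X \<union> Y"
    "(v \<in> closed_nbhd E X) \<noteq> (v \<in> closed_nbhd E Y)" for v
  proof -
    have "\<exists>w\<in>V. {v, w} \<in> E \<and> w \<notin> closed_nbhd E X \<and> w \<notin> closed_nbhd E Y" using dom v by simp
    then obtain w where w: "w \<in> R" "{w, v} \<in> E" by (auto simp: R_def insert_commute)
    have "\<exists>b\<in>X \<union> Y. {b, v} \<in> E" using v unfolding closed_nbhd_def by blast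
    then obtain b where b: "b \<in> X \<union> Y" "{b, v} \<in> E" by blast
    have "v \<notin> comp w" using comp_sub[OF w(1)] v by (auto simp: R_def)
    then have "{f w, v} \<in> E"
      using f(2)[OF w(1), of v w b] v b w by (auto simp: comp_def)
    moreover have "f w \<in> S" using S(1) w(1) by blast
    ultimately show ?thesis by (metis insert_commute)
  qed
  have XYnear: "v \<in> closed_nbhd E X" "v \<in> closed_nbhd E Y" if "v \<in> X \<union> Y" for v
  proof -
    obtain x y where "x \<in> X" "y \<in> Y" using XY by blast
    then show "v \<in> closed_nbhd E X" "v \<in> closed_nbhd E Y"
      using that XY(3)[of x v] XY(3)[of v y] by (auto simp: closed_nbhd_def insert_commute)
  qed
  \<comment> \<open>Stated for a general \<open>Z\<close> to cover \<open>X\<close> and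
    \<open>Y\<close> at once. A vertex outside \<open>S \<union> Z\<close> is dominated by
    \<open>Z\<close>, lies in \<open>R\<close>, or lies in exactly one closed neighbourhood.\<close>
  have max: "maximal_independent_set V E (S \<union> Z)"
    if Z: "Z \<subseteq> X \<union> Y" "independent_set V E Z"
      "\<And>v. v \<in> X \<union> Y \<Longrightarrow> v \<in> closed_nbhd E Z" "closed_nbhd E Z = closed_nbhd E X \<or> closed_nbhd E Z = closed_nbhd E Y" for Z
    unfolding maximal_independent_set_iff[OF G]
  proof (intro conjI ballI)
    show "independent_set V E (S \<union> Z)"
      using S(2,3) Z(1,2) RXY unfolding independent_set_def indep_def
      by (auto simp: insert_commute) (metis (no_types, lifting) UnCI UnE insert_commute subsetD)+
    fix v assume v: "v \<in> V - (S \<union> Z)"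
    consider "v \<in> closed_nbhd E Z" | "v \<in> R" | "v \<notin> X \<union> Y" "(v \<in> closed_nbhd E X) \<noteq> (v \<in> closed_nbhd E Y)"
      using v Z(3,4) by (auto simp: R_def)
    then show "\<exists>w\<in>S \<union> Z. {v, w} \<in> E"
    proof cases
      case 1 then show ?thesis using v by (auto simp: closed_nbhd_def insert_commute)
    next
      case 2 then show ?thesis using S(4)[of v] v by blast
    next
      case 3 then show ?thesis using D[of v] v by blast
    qed
  qed
  have "maximal_independent_set V E (S \<union> X)" "maximal_independent_set V E (S \<union> Y)"
    using max[of X] max[of Y] XYnear XY by auto
  then show "generating V E X Y" using S(3) unfolding generating_def by blast
qed

section \<open>Programs that leave the memory unchanged\<close>

text \<open>A total-correctness triple with a time bound. The same \<open>m\<close> stands before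
  and after, so postconditions mention registers only; \<open>T\<close> is an upper bound, so
  branches of different cost can be padded.\<close>

definition runs ::
    "ram \<Rightarrow> (nat \<Rightarrow> nat) \<Rightarrow> (nat \<Rightarrow> nat) \<Rightarrow> nat \<Rightarrow> ((nat \<Rightarrow> nat) \<Rightarrow> bool) \<Rightarrow> bool" where
  "runs c m r T Q \<longleftrightarrow> (\<exists>t r'. ram_exec c (r, m) t (r', m) \<and> t \<le> T \<and> Q r')"

lemma runs_mono:
  "runs c m r T Q \<Longrightarrow> T \<le> T' \<Longrightarrow> (\<And>r'. Q r' \<Longrightarrow> Q' r') \<Longrightarrow> runs c m r T' Q'"
  unfolding runs_def by (meson order_trans)

lemma runs_Skip: "Q r \<Longrightarrow> runs Ram_Skip m r 1 Q"
  and runs_Const: "Q (r(i := k)) \<Longrightarrow> runs (Ram_Const i k) m r 1 Q"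
  and runs_Add: "Q (r(i := r j + r k)) \<Longrightarrow> runs (Ram_Add i j k) m r 1 Q"
  and runs_Sub: "Q (r(i := r j - r k)) \<Longrightarrow> runs (Ram_Sub i j k) m r 1 Q"
  and runs_Load: "Q (r(i := m (r j))) \<Longrightarrow> runs (Ram_Load i j) m r 1 Q"
  unfolding runs_def by (blast intro: ram_exec.intros)+

text \<open>The second program sits in the postcondition of the first, so a sequence is taken apart
  without naming an intermediate assertion.\<close>

lemma runs_Seq:
  assumes "runs c m r T (\<lambda>r'. runs d m r' U Q)"
  shows "runs (Ram_Seq c d) m r (T + U) Q"
  using assms unfolding runs_def by (meson add_mono ram_exec.Seq)

lemma runs_If:
  assumes "r i \<noteq> 0 \<Longrightarrow> runs c m r T Q" "r i = 0 \<Longrightarrow> runs d m r T Q"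
  shows "runs (Ram_If i c d) m r (Suc T) Q"
  using assms unfolding runs_def
  by (cases "r i = 0") (meson Suc_le_mono ram_exec.IfTrue ram_exec.IfFalse)+

text \<open>The invariant counts iterations, and \<open>k < n\<close> in the body premise gives
  termination. Each remaining round costs a test and the body, with one final test; leaving before
  round \<open>n\<close> is allowed.\<close>

lemma runs_While:
  assumes "I k r"
    and body: "\<And>k r. I k r \<Longrightarrow> r i \<noteq> 0 \<Longrightarrow> k < n \<and> runs c m r T (I (Suc k))"
    and exit: "\<And>k r. I k r \<Longrightarrow> r i = 0 \<Longrightarrow> Q r"
  shows "runs (Ram_While i c) m r (Suc ((n - k) * Suc T)) Q"
  using assms(1)
proof (induction "n - k" arbitrary: k r)
  case 0
  then have "r i = 0" using body by fastforce
  then show ?case using exit[OF 0(2)] ram_exec.WhileFalse[of r i c m] unfolding runs_def by force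
next
  case (Suc l)
  show ?case
  proof (cases "r i = 0")
    case True
    then show ?thesis using exit[OF Suc.prems] ram_exec.WhileFalse[of r i c m] unfolding runs_def by force
  next
    case False
    then obtain t r' where 1: "ram_exec c (r, m) t (r', m)" "t \<le> T" "I (Suc k) r'"
      using body[OF Suc.prems] unfolding runs_def by blast
    have l: "l = n - Suc k" using Suc.hyps(2) by simp
    from Suc.hyps(1)[OF this 1(3)] obtain u r'' where
      2: "ram_exec (Ram_While i c) (r', m) u (r'', m)" "u \<le> Suc (l * Suc T)" "Q r''"
      unfolding runs_def l by blast
    have "Suc (t + u) \<le> Suc (Suc l * Suc T)" using 1 2 by simp
    then show ?thesis
      using ram_exec.WhileTrue[of r i c m, OF False 1(1) 2(1)] 2(3) Suc.hyps(2)
      unfolding runs_def by metis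
  qed
qed

section \<open>First-order properties are decidable in polynomial time\<close>

text \<open>Variables are de Bruijn levels: a formula evaluated in an environment \<open>es\<close> binds, in its
  outermost quantifiers, the variable \<open>length es\<close>.\<close>

datatype fo =
    Edge nat nat
  | Mark bool nat
  | Neg fo
  | Conj fo fo
  | Ex fo

fun fo_holds :: "nat \<Rightarrow> (nat \<Rightarrow> nat \<Rightarrow> bool) \<Rightarrow> (bool \<Rightarrow> nat \<Rightarrow> bool) \<Rightarrow> fo \<Rightarrow> nat list \<Rightarrow> bool" where
  "fo_holds n adj mark (Edge i j) es \<longleftrightarrow> adj (es ! i) (es ! j)"
| "fo_holds n adj mark (Mark b i) es \<longleftrightarrow> mark b (es ! i)"
| "fo_holds n adj mark (Neg \<phi>) es \<longleftrightarrow> \<not> fo_holds n adj mark \<phi> es"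
| "fo_holds n adj mark (Conj \<phi> \<psi>) es \<longleftrightarrow> fo_holds n adj mark \<phi> es \<and> fo_holds n adj mark \<psi> es"
| "fo_holds n adj mark (Ex \<phi>) es \<longleftrightarrow> (\<exists>a<n. fo_holds n adj mark \<phi> (es @ [a]))"

fun fo_wf :: "nat \<Rightarrow> fo \<Rightarrow> bool" where
  "fo_wf d (Edge i j) \<longleftrightarrow> i < d \<and> j < d"
| "fo_wf d (Mark b i) \<longleftrightarrow> i < d"
| "fo_wf d (Neg \<phi>) \<longleftrightarrow> fo_wf d \<phi>"
| "fo_wf d (Conj \<phi> \<psi>) \<longleftrightarrow> fo_wf d \<phi> \<and> fo_wf d \<psi>"
| "fo_wf d (Ex \<phi>) \<longleftrightarrow> fo_wf (Suc d) \<phi>"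

text \<open>Register 0 receives the truth value, register 1 is scratch space and the loop flag,
  register 2 holds 1, register 3 the number \<open>n\<close> of vertices, and registers 4, 5, 6 the addresses of
  the adjacency matrix and of the two vertex sets. As there is no multiplication, variable \<open>i\<close>
  with value \<open>a\<close> occupies two registers: \<open>7 + 2 * i\<close> holds \<open>a\<close> and \<open>8 + 2 * i\<close> holds \<open>n * a\<close>.\<close>

fun fo_compile :: "nat \<Rightarrow> fo \<Rightarrow> ram" where
  "fo_compile d (Edge i j) =
     Ram_Seq (Ram_Add 1 4 (8 + 2 * i)) (Ram_Seq (Ram_Add 1 1 (7 + 2 * j)) (Ram_Load 0 1))"
| "fo_compile d (Mark b i) =
     Ram_Seq (Ram_Add 1 (if b then 6 else 5) (7 + 2 * i)) (Ram_Load 0 1)"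
| "fo_compile d (Neg \<phi>) = Ram_Seq (fo_compile d \<phi>) (Ram_Sub 0 2 0)"
| "fo_compile d (Conj \<phi> \<psi>) = Ram_Seq (fo_compile d \<phi>) (Ram_If 0 (fo_compile d \<psi>) Ram_Skip)"
| "fo_compile d (Ex \<phi>) =
     Ram_Seq (Ram_Const (7 + 2 * d) 0) (Ram_Seq (Ram_Const (8 + 2 * d) 0)
      (Ram_Seq (Ram_Const 0 0) (Ram_Seq (Ram_Add 1 0 3)
       (Ram_While 1 (Ram_Seq (fo_compile (Suc d) \<phi>)
         (Ram_If 0 (Ram_Const 1 0)
           (Ram_Seq (Ram_Add (7 + 2 * d) (7 + 2 * d) 2)
            (Ram_Seq (Ram_Add (8 + 2 * d) (8 + 2 * d) 3) (Ram_Sub 1 3 (7 + 2 * d))))))))))"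

text \<open>For \<open>Ex\<close>, the constant 5 is four initialising instructions and the last
  loop test; each of the at most \<open>n\<close> rounds adds 5 to the body for the loop test, the
  branch and up to three updates.\<close>

fun fo_time :: "fo \<Rightarrow> nat poly" where
  "fo_time (Edge i j) = [:3:]"
| "fo_time (Mark b i) = [:2:]"
| "fo_time (Neg \<phi>) = fo_time \<phi> + [:1:]"
| "fo_time (Conj \<phi> \<psi>) = fo_time \<phi> + fo_time \<psi> + [:2:]"
| "fo_time (Ex \<phi>) = [:5:] + [:0, 1:] * (fo_time \<phi> + [:5:])"

definition fo_ready :: "nat \<Rightarrow> nat \<Rightarrow> nat \<Rightarrow> nat \<Rightarrow> nat list \<Rightarrow> (nat \<Rightarrow> nat) \<Rightarrow> bool" where
  "fo_ready n A B B' es r \<longleftrightarrow> r 2 = 1 \<and> r 3 = n \<and> r 4 = A \<and> r 5 = B \<and> r 6 = B' \<and>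
     (\<forall>i<length es. es ! i < n \<and> r (7 + 2 * i) = es ! i \<and> r (8 + 2 * i) = n * es ! i)"

text \<open>Registers 0 and 1 are scratch, and those from \<open>7 + 2 * length es\<close> on belong
  to inner quantifiers; changes there keep the environment.\<close>

lemma fo_ready_cong:
  assumes "fo_ready n A B B' es r" "\<And>i. 2 \<le> i \<Longrightarrow> i < 7 + 2 * length es \<Longrightarrow> r' i = r i"
  shows "fo_ready n A B B' es r'"
  using assms unfolding fo_ready_def by simp

lemma fo_ready_snoc:
  "fo_ready n A B B' (es @ [a]) r \<longleftrightarrow> fo_ready n A B B' es r \<and>
     a < n \<and> r (7 + 2 * length es) = a \<and> r (8 + 2 * length es) = n * a"
  unfolding fo_ready_def by (auto simp: nth_append less_Suc_eq)

text \<open>Besides the truth value, the induction carries a frame clause: code for a subformula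
  preserves the constants and the variables in scope. This lets conjunctions and enclosing loops go
  on after it.\<close>

lemma runs_fo_compile:
  assumes adj: "\<And>a b. a < n \<Longrightarrow> b < n \<Longrightarrow> m (A + n * a + b) = of_bool (adj a b)"
    and mark: "\<And>a. a < n \<Longrightarrow> m (B + a) = of_bool (mark False a)"
      "\<And>a. a < n \<Longrightarrow> m (B' + a) = of_bool (mark True a)"
  shows "fo_wf (length es) \<phi> \<Longrightarrow> fo_ready n A B B' es r \<Longrightarrow>
    runs (fo_compile (length es) \<phi>) m r (poly (fo_time \<phi>) n)
      (\<lambda>r'. r' 0 = of_bool (fo_holds n adj mark \<phi> es) \<and>
        (\<forall>i. 2 \<le> i \<and> i < 7 + 2 * length es \<longrightarrow> r' i = r i))"
proof (induction \<phi> arbitrary: es r)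
  case (Edge i j)
  have "runs (fo_compile (length es) (Edge i j)) m r (1 + (1 + 1))
      (\<lambda>r'. r' 0 = of_bool (fo_holds n adj mark (Edge i j) es) \<and>
        (\<forall>i. 2 \<le> i \<and> i < 7 + 2 * length es \<longrightarrow> r' i = r i))"
    unfolding fo_compile.simps
    by (intro runs_Seq runs_Add runs_Load)
      (use Edge adj[of "es ! i" "es ! j"] in \<open>simp add: fo_ready_def\<close>)
  then show ?case by (rule runs_mono) auto
next
  case (Mark b i)
  have "runs (fo_compile (length es) (Mark b i)) m r (1 + 1)
      (\<lambda>r'. r' 0 = of_bool (fo_holds n adj mark (Mark b i) es) \<and>
        (\<forall>i. 2 \<le> i \<and> i < 7 + 2 * length es \<longrightarrow> r' i = r i))"
    unfolding fo_compile.simps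
    by (intro runs_Seq runs_Add runs_Load)
      (use Mark mark[of "es ! i"] in \<open>simp add: fo_ready_def; cases b; simp\<close>)
  then show ?case by (rule runs_mono) auto
next
  case (Neg \<phi>)
  have "r 2 = 1" using Neg.prems by (simp add: fo_ready_def)
  have "runs (fo_compile (length es) \<phi>) m r (poly (fo_time \<phi>) n)
      (\<lambda>r'. r' 0 = of_bool (fo_holds n adj mark \<phi> es) \<and>
        (\<forall>i. 2 \<le> i \<and> i < 7 + 2 * length es \<longrightarrow> r' i = r i))"
    using Neg by simp
  then have "runs (fo_compile (length es) (Neg \<phi>)) m r (poly (fo_time \<phi>) n + 1)
      (\<lambda>r'. r' 0 = of_bool (fo_holds n adj mark (Neg \<phi>) es) \<and>
        (\<forall>i. 2 \<le> i \<and> i < 7 + 2 * length es \<longrightarrow> r' i = r i))"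
    unfolding fo_compile.simps
    \<comment> \<open>Subtracting a bit from the 1 in register 2 negates it.\<close>
    by (intro runs_Seq, elim runs_mono[OF _ order_refl]) (intro runs_Sub, auto simp: \<open>r 2 = 1\<close>)
  then show ?case by (rule runs_mono) auto
next
  case (Conj \<phi> \<psi>)
  let ?F = "\<lambda>r'. \<forall>i. 2 \<le> i \<and> i < 7 + 2 * length es \<longrightarrow> r' i = r i"
  have 1: "runs (fo_compile (length es) \<phi>) m r (poly (fo_time \<phi>) n)
      (\<lambda>r'. r' 0 = of_bool (fo_holds n adj mark \<phi> es) \<and> ?F r')"
    using Conj.IH(1)[OF _ Conj.prems(2)] Conj.prems by simp
  have 2: "runs (Ram_If 0 (fo_compile (length es) \<psi>) Ram_Skip) m s (Suc (Suc (poly (fo_time \<psi>) n)))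
      (\<lambda>r'. r' 0 = of_bool (fo_holds n adj mark (Conj \<phi> \<psi>) es) \<and> ?F r')"
    if s: "s 0 = of_bool (fo_holds n adj mark \<phi> es) \<and> ?F s" for s
  proof (rule runs_If)
    assume "s 0 \<noteq> 0"
    have "fo_ready n A B B' es s" using fo_ready_cong[OF Conj.prems(2)] s by simp
    then have "runs (fo_compile (length es) \<psi>) m s (poly (fo_time \<psi>) n)
      (\<lambda>r'. r' 0 = of_bool (fo_holds n adj mark \<psi> es) \<and>
        (\<forall>i. 2 \<le> i \<and> i < 7 + 2 * length es \<longrightarrow> r' i = s i))"
      using Conj.IH(2) Conj.prems by simp
    then show "runs (fo_compile (length es) \<psi>) m s (Suc (poly (fo_time \<psi>) n))
      (\<lambda>r'. r' 0 = of_bool (fo_holds n adj mark (Conj \<phi> \<psi>) es) \<and> ?F r')"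
      by (rule runs_mono) (use s \<open>s 0 \<noteq> 0\<close> in auto)
  next
    \<comment> \<open>Register 0 already holds the value of the false conjunction.\<close>
    assume "s 0 = 0"
    then show "runs Ram_Skip m s (Suc (poly (fo_time \<psi>) n))
      (\<lambda>r'. r' 0 = of_bool (fo_holds n adj mark (Conj \<phi> \<psi>) es) \<and> ?F r')"
      by (intro runs_mono[OF runs_Skip[of "\<lambda>r'. r' = s"]]) (use s in auto)
  qed
  have "runs (fo_compile (length es) (Conj \<phi> \<psi>)) m r
      (poly (fo_time \<phi>) n + Suc (Suc (poly (fo_time \<psi>) n)))
      (\<lambda>r'. r' 0 = of_bool (fo_holds n adj mark (Conj \<phi> \<psi>) es) \<and> ?F r')"
    unfolding fo_compile.simps by (intro runs_Seq runs_mono[OF 1 order_refl]) (rule 2)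
  then show ?case by (rule runs_mono) auto
next
  case (Ex \<phi>)
  let ?d = "length es"
  let ?T = "poly (fo_time \<phi>) n"
  let ?H = "\<lambda>a. fo_holds n adj mark \<phi> (es @ [a])"
  let ?F = "\<lambda>r'. \<forall>i. 2 \<le> i \<and> i < 7 + 2 * ?d \<longrightarrow> r' i = r i"
  \<comment> \<open>Either a witness was found, with answer 1 and the flag cleared, or the first
    \<open>a\<close> candidates failed and the flag is \<open>n - a\<close>, which vanishes exactly
    when all have been tried.\<close>
  define I where "I a s \<longleftrightarrow> ?F s \<and>
    ((s 1 = 0 \<and> s 0 = 1 \<and> (\<exists>b<n. ?H b)) \<or>
     (a \<le> n \<and> s (7 + 2 * ?d) = a \<and> s (8 + 2 * ?d) = n * a \<and> (\<forall>b<a. \<not> ?H b) \<and>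
      s 0 = 0 \<and> s 1 = n - a))"
    for a :: nat and s :: "nat \<Rightarrow> nat"
  let ?next = "Ram_If 0 (Ram_Const 1 0)
     (Ram_Seq (Ram_Add (7 + 2 * ?d) (7 + 2 * ?d) 2)
      (Ram_Seq (Ram_Add (8 + 2 * ?d) (8 + 2 * ?d) 3) (Ram_Sub 1 3 (7 + 2 * ?d))))"
  have r: "r 2 = 1" "r 3 = n" using Ex.prems(2) by (auto simp: fo_ready_def)
  have body: "a < n \<and> runs (Ram_Seq (fo_compile (Suc ?d) \<phi>) ?next) m s (?T + 4) (I (Suc a))"
    if inv: "I a s" "s 1 \<noteq> 0" for a s
  proof -
    have s: "?F s" "s (7 + 2 * ?d) = a" "s (8 + 2 * ?d) = n * a" "\<forall>b<a. \<not> ?H b" "a < n"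
      using inv by (auto simp: I_def)
    have "fo_ready n A B B' es s" using fo_ready_cong[OF Ex.prems(2)] s by simp
    then have "fo_ready n A B B' (es @ [a]) s" using s by (simp add: fo_ready_snoc)
    \<comment> \<open>The frame bound is \<open>7 + 2 * Suc ?d\<close>, so the body also preserves
      the two registers of the loop variable.\<close>
    then have 1: "runs (fo_compile (Suc ?d) \<phi>) m s ?T
      (\<lambda>r'. r' 0 = of_bool (?H a) \<and> (\<forall>i. 2 \<le> i \<and> i < 9 + 2 * ?d \<longrightarrow> r' i = s i))"
      using Ex.IH[of "es @ [a]" s] Ex.prems(1) by simp
    have 2: "runs ?next m u (Suc (1 + (1 + 1))) (I (Suc a))"
      if u: "u 0 = of_bool (?H a) \<and> (\<forall>i. 2 \<le> i \<and> i < 9 + 2 * ?d \<longrightarrow> u i = s i)" for u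
    proof (rule runs_If)
      assume "u 0 \<noteq> 0"
      then have "u 0 = 1" "?H a" using u by (auto split: if_splits)
      then have "runs (Ram_Const 1 0) m u 1 (I (Suc a))"
        using u s by (intro runs_Const) (auto simp: I_def)
      then show "runs (Ram_Const 1 0) m u (1 + (1 + 1)) (I (Suc a))" by (rule runs_mono) auto
    next
      assume "u 0 = 0"
      then have "\<not> ?H a" using u by auto
      then have "\<forall>b<Suc a. \<not> ?H b" using s(4) by (simp add: less_Suc_eq)
      then show "runs (Ram_Seq (Ram_Add (7 + 2 * ?d) (7 + 2 * ?d) 2)
          (Ram_Seq (Ram_Add (8 + 2 * ?d) (8 + 2 * ?d) 3) (Ram_Sub 1 3 (7 + 2 * ?d)))) m u
          (1 + (1 + 1)) (I (Suc a))"
        using u s r \<open>u 0 = 0\<close> by (intro runs_Seq runs_Add runs_Sub) (simp add: I_def)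
    qed
    have "runs (Ram_Seq (fo_compile (Suc ?d) \<phi>) ?next) m s (?T + Suc (1 + (1 + 1))) (I (Suc a))"
      by (intro runs_Seq runs_mono[OF 1 order_refl]) (rule 2)
    then show ?thesis using s(5) by (simp add: eval_nat_numeral)
  qed
  have loop: "runs (Ram_While 1 (Ram_Seq (fo_compile (Suc ?d) \<phi>) ?next)) m s
      (Suc ((n - 0) * Suc (?T + 4)))
      (\<lambda>r'. r' 0 = of_bool (fo_holds n adj mark (Ex \<phi>) es) \<and> ?F r')" if "I 0 s" for s
    by (rule runs_While[where I = I, OF that body]) (auto simp: I_def)
  \<comment> \<open>Adding registers 0 and 3 while register 0 is 0 loads the flag with
    \<open>n\<close>, which establishes \<open>I 0\<close>.\<close>
  have "runs (fo_compile ?d (Ex \<phi>)) m r (1 + (1 + (1 + (1 + Suc ((n - 0) * Suc (?T + 4))))))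
      (\<lambda>r'. r' 0 = of_bool (fo_holds n adj mark (Ex \<phi>) es) \<and> ?F r')"
    unfolding fo_compile.simps
    by (intro runs_Seq runs_Const runs_Add loop) (simp add: I_def r)
  then show ?case by (rule runs_mono) (auto simp: algebra_simps)
qed

section \<open>Reading the input\<close>

text \<open>Scanning the unary prefix puts \<open>n\<close> into register 3, and the matrix starts
  one cell after the separator. The two vertex sets are located backwards from the end of the input,
  which avoids computing \<open>n * n\<close>.\<close>

definition fo_decide :: "fo \<Rightarrow> ram" where
  "fo_decide \<phi> = Ram_Seq (Ram_Const 2 1) (Ram_Seq (Ram_Const 3 0) (Ram_Seq (Ram_Load 1 3)
     (Ram_Seq (Ram_While 1 (Ram_Seq (Ram_Add 3 3 2) (Ram_Load 1 3)))
     (Ram_Seq (Ram_Sub 6 0 3) (Ram_Seq (Ram_Sub 5 6 3) (Ram_Seq (Ram_Add 4 3 2)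
       (fo_compile 0 \<phi>)))))))"

lemma runs_fo_decide:
  assumes "fo_wf 0 \<phi>" and unary: "\<And>i. i < n \<Longrightarrow> m i = 1" "m n = 0"
    and adj: "\<And>a b. a < n \<Longrightarrow> b < n \<Longrightarrow> m (Suc n + n * a + b) = of_bool (adj a b)"
    and mark: "\<And>a. a < n \<Longrightarrow> m (r 0 - n - n + a) = of_bool (mark False a)"
      "\<And>a. a < n \<Longrightarrow> m (r 0 - n + a) = of_bool (mark True a)"
  shows "runs (fo_decide \<phi>) m r (7 + 3 * n + poly (fo_time \<phi>) n)
    (\<lambda>r'. r' 0 = of_bool (fo_holds n adj mark \<phi> []))"
proof -
  \<comment> \<open>After \<open>k\<close> ones, register 1 holds bit \<open>k\<close>; as the first
    zero is at \<open>n\<close>, the scan stops exactly there.\<close>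
  define I where "I k s \<longleftrightarrow> k \<le> n \<and> s 0 = r 0 \<and> s 2 = 1 \<and> s 3 = k \<and> s 1 = m k"
    for k :: nat and s :: "nat \<Rightarrow> nat"
  have body: "k < n \<and> runs (Ram_Seq (Ram_Add 3 3 2) (Ram_Load 1 3)) m s (1 + 1) (I (Suc k))"
    if "I k s" "s 1 \<noteq> 0" for k s
  proof
    show "k < n" using that unary(2) by (auto simp: I_def le_less)
    then show "runs (Ram_Seq (Ram_Add 3 3 2) (Ram_Load 1 3)) m s (1 + 1) (I (Suc k))"
      using that by (intro runs_Seq runs_Add runs_Load) (simp add: I_def)
  qed
  let ?Q = "\<lambda>r'. r' 0 = of_bool (fo_holds n adj mark \<phi> [])"
  let ?rest = "Ram_Seq (Ram_Sub 6 0 3) (Ram_Seq (Ram_Sub 5 6 3) (Ram_Seq (Ram_Add 4 3 2)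
       (fo_compile 0 \<phi>)))"
  let ?T = "1 + (1 + (1 + poly (fo_time \<phi>) n))"
  have rest: "runs ?rest m s ?T ?Q" if "I n s" for s
  proof (intro runs_Seq runs_Add runs_Sub)
    let ?s = "s(6 := s 0 - s 3)"
    let ?s = "?s(5 := ?s 6 - ?s 3)"
    let ?s = "?s(4 := ?s 3 + ?s 2)"
    have "fo_ready n (Suc n) (r 0 - n - n) (r 0 - n) [] ?s"
      using that by (simp add: fo_ready_def I_def)
    then have "runs (fo_compile (length ([] :: nat list)) \<phi>) m ?s (poly (fo_time \<phi>) n)
      (\<lambda>r'. r' 0 = of_bool (fo_holds n adj mark \<phi> []) \<and>
        (\<forall>i. 2 \<le> i \<and> i < 7 + 2 * length ([] :: nat list) \<longrightarrow> r' i = ?s i))"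
      by (intro runs_fo_compile) (use assms in simp_all)
    then show "runs (fo_compile 0 \<phi>) m ?s (poly (fo_time \<phi>) n) ?Q"
      unfolding list.size(3) by (rule runs_mono) auto
  qed
  have loop: "runs (Ram_While 1 (Ram_Seq (Ram_Add 3 3 2) (Ram_Load 1 3))) m s
      (Suc ((n - 0) * Suc (1 + 1))) (\<lambda>s. runs ?rest m s ?T ?Q)" if "I 0 s" for s
  proof (rule runs_While[where I = I, OF that body])
    show "runs ?rest m s ?T ?Q" if "I k s" "s 1 = 0" for k s
      using that unary(1)[of k] by (intro rest) (cases "k = n"; auto simp: I_def)
  qed
  have "runs (fo_decide \<phi>) m r (1 + (1 + (1 + (Suc ((n - 0) * Suc (1 + 1)) + ?T)))) ?Q"
    unfolding fo_decide_def
    by (intro runs_Seq runs_Const runs_Load loop) (simp add: I_def)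
  then show ?thesis by (rule runs_mono) auto
qed

section \<open>Layout of the encoded instance\<close>

lemma poly_nat_mono: "n \<le> k \<Longrightarrow> poly p n \<le> poly p k" for p :: "nat poly"
  by (induction p) (auto intro: add_mono mult_mono)

lemma nth_concat_uniform:
  assumes "\<And>x. x \<in> set xs \<Longrightarrow> length (f x) = k" "i < length xs" "j < k"
  shows "concat (map f xs) ! (k * i + j) = f (xs ! i) ! j"
  using assms
proof (induction xs arbitrary: i)
  case (Cons x xs)
  then show ?case by (cases i) (auto simp: nth_append)
qed simp

lemma length_concat_uniform:
  "(\<And>x. x \<in> set xs \<Longrightarrow> length (f x) = k) \<Longrightarrow> length (concat (map f xs)) = k * length xs"
  by (induction xs) auto

text \<open>The formula is fixed, so one program and one polynomial serve all instances. Quantifiers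
  range over positions in \<open>vs\<close>, and the unary prefix ensures that the number of
  vertices is at most the input length.\<close>

theorem polytime_decidable_fo:
  assumes "fo_wf 0 \<phi>"
    and "\<And>vs E X Y. (vs, E, X, Y) \<in> I \<Longrightarrow> Q (vs, E, X, Y) \<longleftrightarrow>
      fo_holds (length vs) (\<lambda>a b. {vs ! a, vs ! b} \<in> E)
        (\<lambda>b a. vs ! a \<in> (if b then Y else X)) \<phi> []"
  shows "polytime_decidable bipartite_instance_code I Q"
  unfolding polytime_decidable_def
proof (rule exI[of _ "fo_decide \<phi>"], rule exI[of _ "[:7, 3:] + fo_time \<phi>"], rule ballI)
  fix inst assume "inst \<in> I"
  obtain vs E X Y where inst: "inst = (vs, E, X, Y)" by (cases inst) auto
  define n where "n = length vs"
  define M where "M = concat (map (\<lambda>u. map (\<lambda>v. {u, v} \<in> E) vs) vs)"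
  define w where "w = bipartite_instance_code inst"
  have w: "w = replicate n True @ [False] @ M @ map (\<lambda>v. v \<in> X) vs @ map (\<lambda>v. v \<in> Y) vs"
    by (simp add: w_def inst graph_code_def vertex_set_code_def n_def M_def)
  have lenM: "length M = n * n" by (simp add: M_def length_concat_uniform n_def)
  have lenw: "length w = Suc n + n * n + n + n" by (simp add: w lenM n_def)
  have M: "M ! (n * a + b) \<longleftrightarrow> {vs ! a, vs ! b} \<in> E" if "a < n" "b < n" for a b
    using that nth_concat_uniform[of vs "\<lambda>u. map (\<lambda>v. {u, v} \<in> E) vs" n a b]
    by (simp add: M_def n_def)
  \<comment> \<open>The addressed entry stays inside the matrix block, before the characteristic
    vectors.\<close>
  have lt: "n * a + b < n * n" if "a < n" "b < n" for a b
  proof -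
    have "n * a + b < n * Suc a" using that by simp
    also have "\<dots> \<le> n * n" using that by (intro mult_le_mono) auto
    finally show ?thesis .
  qed
  define r :: "nat \<Rightarrow> nat" where "r = (\<lambda>_. 0)(0 := length w)"
  define m :: "nat \<Rightarrow> nat" where "m = (\<lambda>i. of_bool (i < length w \<and> w ! i))"
  have init: "ram_init w = (r, m)" by (simp add: ram_init_def r_def m_def)
  have r0: "r 0 = length w" by (simp add: r_def)
  have "runs (fo_decide \<phi>) m r (7 + 3 * n + poly (fo_time \<phi>) n)
    (\<lambda>r'. r' 0 = of_bool (fo_holds n (\<lambda>a b. {vs ! a, vs ! b} \<in> E)
        (\<lambda>b a. vs ! a \<in> (if b then Y else X)) \<phi> []))"
  proof (rule runs_fo_decide[OF assms(1)])
    show "m i = 1" if "i < n" for i using that by (simp add: m_def lenw w nth_append)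
    show "m n = 0" by (simp add: m_def w nth_append)
    show "m (Suc n + n * a + b) = of_bool ({vs ! a, vs ! b} \<in> E)" if "a < n" "b < n" for a b
      using lt[OF that] M[OF that] by (simp add: m_def lenw) (simp add: w nth_append lenM)
    show "m (r 0 - n - n + a) = of_bool (vs ! a \<in> (if False then Y else X))" if "a < n" for a
      using that by (simp add: m_def lenw r0) (simp add: w nth_append lenM n_def)
    show "m (r 0 - n + a) = of_bool (vs ! a \<in> (if True then Y else X))" if "a < n" for a
      using that by (simp add: m_def lenw r0) (simp add: w nth_append lenM n_def)
  qed
  then obtain t r' where t: "ram_exec (fo_decide \<phi>) (ram_init w) t (r', m)"
    "t \<le> 7 + 3 * n + poly (fo_time \<phi>) n" "r' 0 = of_bool (Q inst)"
    using assms(2) \<open>inst \<in> I\<close> unfolding runs_def init inst n_def by auto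
  have "n \<le> length w" by (simp add: lenw)
  then have "t \<le> poly ([:7, 3:] + fo_time \<phi>) (length w)"
    using t(2) poly_nat_mono[of n "length w" "fo_time \<phi>"] by simp
  then show "\<exists>t r m. ram_exec (fo_decide \<phi>) (ram_init (bipartite_instance_code inst)) t (r, m) \<and>
      t \<le> poly ([:7, 3:] + fo_time \<phi>) (length (bipartite_instance_code inst)) \<and>
      r 0 = of_bool (Q inst)"
    using t unfolding w_def by blast
qed

section \<open>The decision procedure\<close>

text \<open>Membership of variable \<open>i\<close> in a closed neighbourhood, with the disjunction
  written by De Morgan. \<open>b\<close> selects \<open>Y\<close> or \<open>X\<close>, and
  \<open>d\<close> must be the number of variables in scope, the level that \<open>Ex\<close>
  binds.\<close>

definition nbhd_fo :: "bool \<Rightarrow> nat \<Rightarrow> nat \<Rightarrow> fo" where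
  "nbhd_fo b i d = Neg (Conj (Neg (Mark b i)) (Neg (Ex (Conj (Mark b d) (Edge d i)))))"

text \<open>The domination criterion, negated twice: no vertex 0 lies in exactly one closed
  neighbourhood without a neighbour 1 lying in neither.\<close>

definition generating_fo :: fo where
  "generating_fo = Neg (Ex (Conj
     (Conj (Neg (Conj (nbhd_fo False 0 1) (nbhd_fo True 0 1)))
       (Neg (Conj (Neg (nbhd_fo False 0 1)) (Neg (nbhd_fo True 0 1)))))
     (Neg (Ex (Conj (Edge 0 1) (Conj (Neg (nbhd_fo False 1 2)) (Neg (nbhd_fo True 1 2))))))))"

lemma bex_set_nth: "(\<exists>x\<in>set vs. P x) \<longleftrightarrow> (\<exists>a<length vs. P (vs ! a))"
  by (metis in_set_conv_nth)

text \<open>Since \<open>X\<close> and \<open>Y\<close> are contained in \<open>set vs\<close>,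
  quantifying over positions reaches all their members.\<close>

lemma fo_holds_nbhd_fo:
  assumes "X \<subseteq> set vs" "Y \<subseteq> set vs" "i < length es" "d = length es"
  shows "fo_holds (length vs) (\<lambda>a b. {vs ! a, vs ! b} \<in> E) (\<lambda>b a. vs ! a \<in> (if b then Y else X))
      (nbhd_fo b i d) es \<longleftrightarrow> vs ! (es ! i) \<in> closed_nbhd E (if b then Y else X)"
proof -
  have "(\<exists>x\<in>Z. {x, v} \<in> E) \<longleftrightarrow> (\<exists>a<length vs. vs ! a \<in> Z \<and> {vs ! a, v} \<in> E)"
    if "Z \<subseteq> set vs" for Z v
    using that bex_set_nth[of vs "\<lambda>x. x \<in> Z \<and> {x, v} \<in> E"] by blast
  then show ?thesis
    using assms by (simp add: nbhd_fo_def closed_nbhd_def nth_append) blast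
qed

lemma generating_iff_fo:
  assumes "simple_graph (set vs) E" "chordal (set vs) E"
    and B: "induced_complete_bipartite (set vs) E X Y"
  shows "generating (set vs) E X Y \<longleftrightarrow>
    fo_holds (length vs) (\<lambda>a b. {vs ! a, vs ! b} \<in> E) (\<lambda>b a. vs ! a \<in> (if b then Y else X))
      generating_fo []"
proof -
  have XY: "X \<subseteq> set vs" "Y \<subseteq> set vs"
    using B by (auto simp: induced_complete_bipartite_def independent_set_def)
  let ?X = "closed_nbhd E X" and ?Y = "closed_nbhd E Y"
  have "generating (set vs) E X Y \<longleftrightarrow>
      \<not> (\<exists>v\<in>set vs. \<not> (v \<in> ?X \<and> v \<in> ?Y) \<and> \<not> (v \<notin> ?X \<and> v \<notin> ?Y) \<and>
        \<not> (\<exists>w\<in>set vs. {v, w} \<in> E \<and> w \<notin> ?X \<and> w \<notin> ?Y))"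
    unfolding generating_iff_dominated[OF assms] by blast
  then show ?thesis
    unfolding bex_set_nth generating_fo_def
    by (simp add: fo_holds_nbhd_fo[OF XY] nth_append)
qed

text \<open>The program is unchanged: \<open>g\<close> only reinterprets the instance behind the
  same bit string.\<close>

lemma polytime_decidable_reindex:
  assumes "polytime_decidable code I Q"
    and "\<And>i. i \<in> J \<Longrightarrow> g i \<in> I" "\<And>i. code' i = code (g i)" "\<And>i. Q' i \<longleftrightarrow> Q (g i)"
  shows "polytime_decidable code' J Q'"
proof -
  obtain c p where "\<forall>i\<in>I. \<exists>t r m. ram_exec c (ram_init (code i)) t (r, m) \<and>
      t \<le> poly p (length (code i)) \<and> r 0 = of_bool (Q i)"
    using assms(1) unfolding polytime_decidable_def by (elim exE)
  then show ?thesis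
    unfolding polytime_decidable_def assms(3,4) using assms(2)
    by (intro exI[of _ c] exI[of _ p] ballI) simp
qed

lemma induced_complete_bipartite_edge:
  assumes "simple_graph V E" "{x, y} \<in> E"
  shows "induced_complete_bipartite V E {x} {y}"
  using simple_graph_edgeD[OF assms] assms(2)
  by (auto simp: induced_complete_bipartite_def independent_set_def indep_def)

theorem corollary2p15:
  shows "polytime_decidable edge_instance_code
      {(vs :: nat list, E, x, y).
         distinct vs \<and> simple_graph (set vs) E \<and> chordal (set vs) E \<and> {x, y} \<in> E}
      (\<lambda>(vs, E, x, y). relating (set vs) E x y)
    \<and> polytime_decidable bipartite_instance_code
      {(vs :: nat list, E, X, Y).
         distinct vs \<and> simple_graph (set vs) E \<and> chordal (set vs) E \<and>
         induced_complete_bipartite (set vs) E X Y}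
      (\<lambda>(vs, E, X, Y). generating (set vs) E X Y)"
proof
  let ?I = "{(vs :: nat list, E, X, Y). distinct vs \<and> simple_graph (set vs) E \<and>
    chordal (set vs) E \<and> induced_complete_bipartite (set vs) E X Y}"
  let ?Q = "\<lambda>(vs, E, X, Y). generating (set vs) E X Y"
  show bip: "polytime_decidable bipartite_instance_code ?I ?Q"
    by (rule polytime_decidable_fo[of generating_fo])
      (auto simp: generating_iff_fo generating_fo_def nbhd_fo_def)
  show "polytime_decidable edge_instance_code
      {(vs :: nat list, E, x, y).
         distinct vs \<and> simple_graph (set vs) E \<and> chordal (set vs) E \<and> {x, y} \<in> E}
      (\<lambda>(vs, E, x, y). relating (set vs) E x y)"
  \<comment> \<open>An edge is coded by the characteristic vectors of \<open>{x}\<close> and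
    \<open>{y}\<close>, so its code is that of the corresponding \<open>K_{1,1}\<close>.\<close>
  proof (rule polytime_decidable_reindex[where g = "\<lambda>(vs, E, x, y). (vs, E, {x}, {y})", OF bip])
    show "(\<lambda>(vs, E, x, y). (vs, E, {x}, {y})) i \<in> ?I"
      if "i \<in> {(vs :: nat list, E, x, y).
         distinct vs \<and> simple_graph (set vs) E \<and> chordal (set vs) E \<and> {x, y} \<in> E}" for i
      using that by (auto intro: induced_complete_bipartite_edge)
  qed (auto simp: relating_def)
qed

end
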